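(* Let $n\ge 1$, $\mathbf{x}\in[0,1]^n$, $H\in\mathbb{R}^{n\times n}$, $\gamma>0$, $\delta=\epsilon\,\mathbf{1}^\top\mathbf{x}>0$, and let $C\in\mathbb{R}^{n\times n}$ be a cost matrix with nonnegative entries and $C_{ij}=0\Leftrightarrow i=j$. The dual problem of $$\min_{\Pi\in\mathbb{R}^{n\times n},\,\Pi\ge0}\ \langle\Pi,H\rangle+\gamma\sum_{i=1}^n\sum_{j=1}^n\Pi_{ij}\log\Pi_{ij}\quad\text{subject to}\quad \Pi\mathbf{1}=\mathbf{x},\ \ \langle\Pi,C\rangle\le\delta$$ is $$\max_{\lambda\ge0}\ -\lambda\delta+\gamma\sum_{i:\,x_i>0}x_i\log x_i-\gamma\sum_{i=1}^n x_i\log\sum_{j=1}^n\exp\left(-\frac{H_{ij}+\lambda C_{ij}}{\gamma}\right).$$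
   Context: $\mathbf{1}\in\mathbb{R}^n$ is the all-ones vector; $\Pi\ge0$ is entrywise; $\langle A,B\rangle=\sum_{i,j}A_{ij}B_{ij}$; the convention $0\log0=0$ is used. "Dual" means the (partial) Lagrangian dual obtained by introducing a multiplier $\lambda\ge0$ for the constraint $\langle\Pi,C\rangle\le\delta$ while keeping the constraints $\Pi\ge0$, $\Pi\mathbf{1}=\mathbf{x}$ explicit, i.e. the dual objective is $\min_{\Pi\ge0,\,\Pi\mathbf{1}=\mathbf{x}}\ \langle\Pi,H\rangle+\gamma\sum_{i,j}\Pi_{ij}\log\Pi_{ij}+\lambda(\langle\Pi,C\rangle-\delta)$. $\epsilon>0$ is a scalar. *)

theory Defs
  imports "HOL-Analysis.Analysis"
begin

text \<open>
  A minimization problem: minimize \<open>objective p\<close> over \<open>p \<in> kept_set\<close> subject to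
  \<open>constraint p \<le> bound\<close>. Only this last inequality receives a multiplier; the constraints
  making up \<open>kept_set\<close> stay explicit in the partial Lagrangian dual.
\<close>

record 'a min_problem =
  objective :: "'a \<Rightarrow> real"
  kept_set :: "'a set"
  constraint :: "'a \<Rightarrow> real"
  bound :: real

definition feasible_set :: "'a min_problem \<Rightarrow> 'a set" where
  "feasible_set M = {p \<in> kept_set M. constraint M p \<le> bound M}"

definition lagrangian :: "'a min_problem \<Rightarrow> real \<Rightarrow> 'a \<Rightarrow> real" where
  "lagrangian M l p = objective M p + l * (constraint M p - bound M)"

text \<open>
  The infimum of a set of reals is meaningful only if the set is nonempty and bounded below;
  statements about \<open>dual_objective\<close> should therefore also assert that a minimizer exists.
\<close>

definition dual_objective :: "'a min_problem \<Rightarrow> real \<Rightarrow> real" where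
  "dual_objective M l = (INF p \<in> kept_set M. lagrangian M l p)"

text \<open>
  On \<open>real ^ 'n ^ 'n\<close> the inner product \<open>\<bullet>\<close> is the sum of the products of corresponding entries,
  and \<open>1 :: real ^ 'n\<close> is the all-ones vector. The convention \<open>0 log 0 = 0\<close> holds
  automatically for \<open>t * ln t\<close>.
\<close>

definition entropic_problem ::
  "real ^ 'n \<Rightarrow> real ^ 'n ^ 'n \<Rightarrow> real ^ 'n ^ 'n \<Rightarrow> real \<Rightarrow> real \<Rightarrow> (real ^ 'n ^ 'n) min_problem" where
  "entropic_problem x H C \<gamma> \<delta> =
     \<lparr> objective = (\<lambda>P. P \<bullet> H + \<gamma> * (\<Sum>i\<in>UNIV. \<Sum>j\<in>UNIV. P $ i $ j * ln (P $ i $ j))),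
       kept_set = {P. (\<forall>i j. 0 \<le> P $ i $ j) \<and> P *v 1 = x},
       constraint = (\<lambda>P. P \<bullet> C),
       bound = \<delta> \<rparr>"

end

theory Submission
  imports Defs
begin

text \<open>
  For a fixed multiplier the Lagrangian splits into the rows of the matrix. On row \<open>i\<close> it is
  \<open>\<gamma>\<close> times \<open>\<Sum>j. p j * ln (p j / w j)\<close> with the Gibbs weights
  \<open>w j = exp (- (H i j + l * C i j) / \<gamma>)\<close>, so the log-sum inequality gives the minimum,
  attained when the row is proportional to \<open>w\<close>. The resulting dual function is continuous, and
  since \<open>C i i = 0\<close> the diagonal term alone bounds each partition function from below,
  so the dual function is at most a constant minus \<open>l * \<delta>\<close> and attains its maximum.
\<close>

text \<open>This is the tangent bound \<open>ln t \<le> t - 1\<close> at \<open>t = q / p\<close>,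
  multiplied by \<open>p\<close>. At \<open>p = 0\<close> the ratio degenerates and only
  \<open>- q \<le> 0\<close> is left.\<close>

lemma diff_le_relative_entropy_term:
  fixes p q :: real
  assumes "0 \<le> p" "0 < q"
  shows "p - q \<le> p * ln p - p * ln q"
proof (cases "p = 0")
  case False
  with assms have p: "0 < p" by simp
  have "ln (q / p) \<le> q / p - 1" using p assms by (intro ln_le_minus_one) simp
  then have "p * ln (q / p) \<le> p * (q / p - 1)" using p by (intro mult_left_mono) auto
  then show ?thesis using p assms by (simp add: ln_div algebra_simps)
qed (use assms in simp)

lemma log_sum_inequality:
  fixes p w :: "'a \<Rightarrow> real"
  assumes "finite J" "J \<noteq> {}" and p: "\<And>j. j \<in> J \<Longrightarrow> 0 \<le> p j" and w: "\<And>j. j \<in> J \<Longrightarrow> 0 < w j"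
  shows "sum p J * ln (sum p J) - sum p J * ln (sum w J) \<le> (\<Sum>j\<in>J. p j * ln (p j) - p j * ln (w j))"
proof (cases "sum p J = 0")
  case True
  then have "\<forall>j\<in>J. p j = 0" using assms by (simp add: sum_nonneg_eq_0_iff)
  then show ?thesis by simp
next
  case False
  define X where "X = sum p J"
  define W where "W = sum w J"
  have X: "0 < X" using False p sum_nonneg[of J p] by (auto simp: X_def)
  have W: "0 < W" unfolding W_def using assms by (intro sum_pos) auto
  \<comment> \<open>Rescaling \<open>w\<close> to the total mass of \<open>p\<close> makes the
    linear terms \<open>p j - q j\<close> cancel in the sum, leaving nonnegativity of the relative
    entropy of \<open>p\<close> with respect to \<open>q\<close>.\<close>
  define q where "q j = X * w j / W" for j
  have "sum q J = X" using W by (simp add: q_def W_def flip: sum_divide_distrib sum_distrib_left)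
  then have "0 = (\<Sum>j\<in>J. p j - q j)" by (simp add: sum_subtractf X_def)
  also have "\<dots> \<le> (\<Sum>j\<in>J. p j * ln (p j) - p j * ln (q j))"
    using p w X W by (intro sum_mono diff_le_relative_entropy_term) (auto simp: q_def)
  also have "\<dots> = (\<Sum>j\<in>J. p j * ln (p j) - p j * ln (w j) - p j * (ln X - ln W))"
    using X W w by (intro sum.cong refl) (simp add: q_def ln_div ln_mult less_imp_neq[THEN not_sym] algebra_simps)
  also have "\<dots> = (\<Sum>j\<in>J. p j * ln (p j) - p j * ln (w j)) - X * (ln X - ln W)"
    by (simp add: sum_subtractf X_def flip: sum_distrib_right)
  finally show ?thesis by (simp add: X_def W_def algebra_simps)
qed

text \<open>Equality case of the log-sum inequality: for multiples of \<open>w\<close> all the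
  ratios inside the logarithm agree, so the common factor \<open>ln X - ln (sum w J)\<close> can be
  pulled out.\<close>

lemma log_sum_equality:
  fixes w :: "'a \<Rightarrow> real" and X :: real
  assumes "finite J" "J \<noteq> {}" and w: "\<And>j. j \<in> J \<Longrightarrow> 0 < w j" and "0 \<le> X"
  shows "(\<Sum>j\<in>J. X * w j / sum w J * ln (X * w j / sum w J) - X * w j / sum w J * ln (w j))
    = X * ln X - X * ln (sum w J)"
proof (cases "X = 0")
  case False
  define W where "W = sum w J"
  have W: "0 < W" unfolding W_def using assms by (intro sum_pos) auto
  have "(\<Sum>j\<in>J. X * w j / W * ln (X * w j / W) - X * w j / W * ln (w j))
      = (\<Sum>j\<in>J. w j * (X * (ln X - ln W) / W))"
    using False assms W
    by (intro sum.cong refl)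
      (simp add: ln_div ln_mult less_imp_neq[THEN not_sym] algebra_simps
        add_divide_distrib diff_divide_distrib)
  also have "\<dots> = W * (X * (ln X - ln W) / W)"
    by (simp only: W_def sum_distrib_right)
  also have "\<dots> = X * ln X - X * ln W"
    using W by (simp add: right_diff_distrib diff_divide_distrib)
  finally show ?thesis by (simp add: W_def)
qed simp

lemma inner_matrix_sum:
  fixes A B :: "real ^ 'm ^ 'n"
  shows "A \<bullet> B = (\<Sum>i\<in>UNIV. \<Sum>j\<in>UNIV. A $ i $ j * B $ i $ j)"
  by (simp add: inner_vec_def)

lemma is_arg_minI:
  fixes f :: "'a \<Rightarrow> 'b::linorder"
  assumes "P x" "\<And>y. P y \<Longrightarrow> f x \<le> f y"
  shows "is_arg_min f P x"
  using assms by (auto simp: is_arg_min_def not_less)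

text \<open>An attained minimum makes the set of values nonempty and bounded below, which is what
  gives the real infimum its meaning.\<close>

lemma INF_eq_is_arg_min:
  fixes f :: "'a \<Rightarrow> real"
  assumes "is_arg_min f (\<lambda>y. y \<in> S) x"
  shows "(INF y\<in>S. f y) = f x"
  using assms by (intro cInf_eq_minimum) (auto simp: is_arg_min_def not_less)

lemma is_arg_max_at_least_if_affine_bound:
  fixes f :: "real \<Rightarrow> real"
  assumes cont: "continuous_on {a..} f" and b: "0 < b"
    and bound: "\<And>t. a \<le> t \<Longrightarrow> f t \<le> B - t * b"
  shows "\<exists>t. is_arg_max f (\<lambda>t. a \<le> t) t"
proof -
  \<comment> \<open>Beyond \<open>(B - f a) / b\<close> the affine bound lies below
    \<open>f a\<close>, so a maximizer on the compact interval up to \<open>L\<close> is global. The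
    \<open>max\<close> places \<open>a\<close> in that interval.\<close>
  define L where "L = max a ((B - f a) / b)"
  have "continuous_on {a..L} f" using cont by (rule continuous_on_subset) auto
  then obtain t where t: "t \<in> {a..L}" "\<And>s. s \<in> {a..L} \<Longrightarrow> f s \<le> f t"
    using continuous_attains_sup[of "{a..L}" f] by (auto simp: L_def)
  have "f s \<le> f t" if "a \<le> s" for s
  proof (cases "s \<le> L")
    case False
    then have "(B - f a) / b < s" by (simp add: L_def)
    then have "B - s * b < f a" using b by (simp add: field_simps)
    moreover have "f a \<le> f t" using t(2)[of a] by (simp add: L_def)
    ultimately show ?thesis using bound[OF that] by linarith
  qed (use that t in auto)
  then show ?thesis using t(1) by (auto simp: is_arg_max_def not_less)
qed

text \<open>The linear costs are absorbed into the entropy as logarithms of Gibbs weights. Keeping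
  \<open>ln (exp ...)\<close> unevaluated gives every row the shape of the log-sum lemmas.\<close>

lemma lagrangian_entropic_problem:
  fixes x :: "real ^ 'n" and H C P :: "real ^ 'n ^ 'n"
  assumes "\<gamma> \<noteq> 0"
  shows "lagrangian (entropic_problem x H C \<gamma> \<delta>) l P =
    - l * \<delta> + \<gamma> * (\<Sum>i\<in>UNIV. \<Sum>j\<in>UNIV. P $ i $ j * ln (P $ i $ j)
      - P $ i $ j * ln (exp (- (H $ i $ j + l * C $ i $ j) / \<gamma>)))"
proof -
  have "\<gamma> * (p * ln p - p * ln (exp (- (h + l * c) / \<gamma>))) = p * h + \<gamma> * (p * ln p) + l * (p * c)"
    for p h c :: real
    using assms by (simp add: field_simps)
  then show ?thesis
    unfolding sum_distrib_left
    by (simp only:) (simp add: lagrangian_def entropic_problem_def inner_matrix_sum sum.distrib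
        right_diff_distrib flip: sum_distrib_left)
qed

lemma kept_set_entropic_problem:
  "P \<in> kept_set (entropic_problem x H C \<gamma> \<delta>) \<longleftrightarrow>
    (\<forall>i j. 0 \<le> P $ i $ j) \<and> (\<forall>i. (\<Sum>j\<in>UNIV. P $ i $ j) = x $ i)"
  by (simp add: entropic_problem_def matrix_vector_mult_def vec_eq_iff)

definition entropic_dual ::
  "real ^ 'n \<Rightarrow> real ^ 'n ^ 'n \<Rightarrow> real ^ 'n ^ 'n \<Rightarrow> real \<Rightarrow> real \<Rightarrow> real \<Rightarrow> real" where
  "entropic_dual x H C \<gamma> \<delta> l =
    - l * \<delta> + \<gamma> * (\<Sum>i | x $ i > 0. x $ i * ln (x $ i))
    - \<gamma> * (\<Sum>i\<in>UNIV. x $ i * ln (\<Sum>j\<in>UNIV. exp (- (H $ i $ j + l * C $ i $ j) / \<gamma>)))"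

lemma entropic_dual_eq_row_sum:
  fixes x :: "real ^ 'n"
  assumes "\<forall>i. 0 \<le> x $ i"
  shows "entropic_dual x H C \<gamma> \<delta> l = - l * \<delta> + \<gamma> * (\<Sum>i\<in>UNIV. x $ i * ln (x $ i)
    - x $ i * ln (\<Sum>j\<in>UNIV. exp (- (H $ i $ j + l * C $ i $ j) / \<gamma>)))"
proof -
  \<comment> \<open>The indices added on the right have \<open>x $ i = 0\<close> and contribute
    \<open>0 * ln 0 = 0\<close>.\<close>
  have "(\<Sum>i | x $ i > 0. x $ i * ln (x $ i)) = (\<Sum>i\<in>UNIV. x $ i * ln (x $ i))"
    using assms by (intro sum.mono_neutral_left) (auto simp: order.order_iff_strict)
  then show ?thesis by (simp add: entropic_dual_def sum_subtractf algebra_simps)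
qed

text \<open>Each row is a softmax scaled to mass \<open>x $ i\<close>: the equality case of the
  log-sum inequality, hence the candidate minimizer.\<close>

definition gibbs_plan ::
  "real ^ 'n \<Rightarrow> real ^ 'n ^ 'n \<Rightarrow> real ^ 'n ^ 'n \<Rightarrow> real \<Rightarrow> real \<Rightarrow> real ^ 'n ^ 'n" where
  "gibbs_plan x H C \<gamma> l = (\<chi> i j. x $ i * exp (- (H $ i $ j + l * C $ i $ j) / \<gamma>)
    / (\<Sum>k\<in>UNIV. exp (- (H $ i $ k + l * C $ i $ k) / \<gamma>)))"

lemma gibbs_plan_in_kept_set:
  fixes x :: "real ^ 'n"
  assumes "\<forall>i. 0 \<le> x $ i"
  shows "gibbs_plan x H C \<gamma> l \<in> kept_set (entropic_problem x H C \<gamma> \<delta>)"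
proof -
  have pos: "(\<Sum>k\<in>UNIV. exp (- (H $ i $ k + l * C $ i $ k) / \<gamma>)) > 0" for i
    by (intro sum_pos) auto
  show ?thesis
    unfolding kept_set_entropic_problem gibbs_plan_def
    using assms less_imp_neq[OF pos, THEN not_sym]
    by (auto simp flip: sum_divide_distrib sum_distrib_left intro!: divide_nonneg_nonneg sum_nonneg)
qed

lemma lagrangian_gibbs_plan:
  fixes x :: "real ^ 'n"
  assumes "\<gamma> > 0" "\<forall>i. 0 \<le> x $ i"
  shows "lagrangian (entropic_problem x H C \<gamma> \<delta>) l (gibbs_plan x H C \<gamma> l) = entropic_dual x H C \<gamma> \<delta> l"
proof -
  have "\<gamma> \<noteq> 0" using assms by simp
  show ?thesis
    unfolding lagrangian_entropic_problem[OF \<open>\<gamma> \<noteq> 0\<close>] entropic_dual_eq_row_sum[OF assms(2)]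
      gibbs_plan_def vec_lambda_beta
    using assms by (subst log_sum_equality) (auto simp del: ln_exp)
qed

lemma entropic_dual_le_lagrangian:
  fixes x :: "real ^ 'n"
  assumes "\<gamma> > 0" "\<forall>i. 0 \<le> x $ i" and P: "P \<in> kept_set (entropic_problem x H C \<gamma> \<delta>)"
  shows "entropic_dual x H C \<gamma> \<delta> l \<le> lagrangian (entropic_problem x H C \<gamma> \<delta>) l P"
proof -
  have "\<gamma> \<noteq> 0" using assms by simp
  have P0: "\<And>i j. 0 \<le> P $ i $ j" and Px: "\<And>i. (\<Sum>j\<in>UNIV. P $ i $ j) = x $ i"
    using P by (auto simp: kept_set_entropic_problem)
  show ?thesis
    unfolding lagrangian_entropic_problem[OF \<open>\<gamma> \<noteq> 0\<close>] entropic_dual_eq_row_sum[OF assms(2)]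
    \<comment> \<open>Writing each \<open>x $ i\<close> as a row sum of \<open>P\<close> turns the
      claim into the log-sum inequality row by row.\<close>
    unfolding Px[symmetric]
    using assms(1) P0
    by (intro add_left_mono mult_left_mono sum_mono log_sum_inequality) auto
qed

lemma continuous_on_entropic_dual:
  "continuous_on S (entropic_dual x H C \<gamma> \<delta>)"
proof -
  have "(\<Sum>j\<in>UNIV. exp (- (H $ i $ j + l * C $ i $ j) / \<gamma>)) \<noteq> 0" for i l
    by (intro less_imp_neq[THEN not_sym] sum_pos) auto
  then show ?thesis
    \<comment> \<open>Division by \<open>\<gamma>\<close> becomes multiplication by a constant,
      which is continuous for any value of \<open>\<gamma>\<close>.\<close>
    unfolding entropic_dual_def divide_inverse by (intro continuous_intros) auto
qed

lemma entropic_dual_affine_bound: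
  fixes x :: "real ^ 'n"
  assumes "\<gamma> > 0" "\<forall>i. 0 \<le> x $ i" "\<forall>i. C $ i $ i = 0"
  shows "entropic_dual x H C \<gamma> \<delta> l \<le>
    (\<gamma> * (\<Sum>i | x $ i > 0. x $ i * ln (x $ i)) + (\<Sum>i\<in>UNIV. x $ i * H $ i $ i)) - l * \<delta>"
proof -
  have "- (x $ i * H $ i $ i) \<le> \<gamma> * (x $ i * ln (\<Sum>j\<in>UNIV. exp (- (H $ i $ j + l * C $ i $ j) / \<gamma>)))"
    (is "_ \<le> \<gamma> * (_ * ln ?Z)") for i
  proof -
    have "exp (- (H $ i $ i + l * C $ i $ i) / \<gamma>) \<le> ?Z"
      by (intro member_le_sum) auto
    \<comment> \<open>Since \<open>C $ i $ i = 0\<close>, this lower bound is independent of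
      \<open>l\<close>, so the slope in \<open>l\<close> of the final bound is exactly
      \<open>- \<delta>\<close>.\<close>
    then have "exp (- H $ i $ i / \<gamma>) \<le> ?Z" using assms(3) by simp
    then have "- H $ i $ i / \<gamma> \<le> ln ?Z"
      by (metis exp_gt_zero ln_exp ln_mono)
    then have "(\<gamma> * x $ i) * (- H $ i $ i / \<gamma>) \<le> (\<gamma> * x $ i) * ln ?Z"
      using assms by (intro mult_left_mono) auto
    then show ?thesis using assms(1) by (simp add: mult.assoc)
  qed
  then have "(\<Sum>i\<in>UNIV. - (x $ i * H $ i $ i))
      \<le> (\<Sum>i\<in>UNIV. \<gamma> * (x $ i * ln (\<Sum>j\<in>UNIV. exp (- (H $ i $ j + l * C $ i $ j) / \<gamma>))))"
    by (intro sum_mono)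
  then show ?thesis
    by (simp add: entropic_dual_def sum_negf flip: sum_distrib_left)
qed

theorem proposition6:
  fixes x :: "real ^ 'n" and H C :: "real ^ 'n ^ 'n" and \<gamma> \<delta> \<epsilon> :: real
  assumes x: "\<forall>i. 0 \<le> x $ i \<and> x $ i \<le> 1"
    and gamma: "\<gamma> > 0"
    and eps: "\<epsilon> > 0"
    and delta: "\<delta> = \<epsilon> * (1 \<bullet> x)" "\<delta> > 0"
    and C_nonneg: "\<forall>i j. 0 \<le> C $ i $ j"
    and C_zero: "\<forall>i j. C $ i $ j = 0 \<longleftrightarrow> i = j"
  shows
    "(\<forall>l\<ge>0.
        (\<exists>P. is_arg_min (lagrangian (entropic_problem x H C \<gamma> \<delta>) l)
               (\<lambda>P. P \<in> kept_set (entropic_problem x H C \<gamma> \<delta>)) P) \<and>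
        dual_objective (entropic_problem x H C \<gamma> \<delta>) l =
          - l * \<delta> + \<gamma> * (\<Sum>i | x $ i > 0. x $ i * ln (x $ i))
          - \<gamma> * (\<Sum>i\<in>UNIV. x $ i * ln (\<Sum>j\<in>UNIV. exp (- (H $ i $ j + l * C $ i $ j) / \<gamma>)))) \<and>
     (\<exists>l. is_arg_max (dual_objective (entropic_problem x H C \<gamma> \<delta>)) (\<lambda>l. 0 \<le> l) l)"
proof -
  let ?M = "entropic_problem x H C \<gamma> \<delta>"
  have x0: "\<forall>i. 0 \<le> x $ i" using x by simp
  have min: "is_arg_min (lagrangian ?M l) (\<lambda>P. P \<in> kept_set ?M) (gibbs_plan x H C \<gamma> l)" for l
    using gibbs_plan_in_kept_set[OF x0] entropic_dual_le_lagrangian[OF gamma x0]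
    by (intro is_arg_minI) (auto simp: lagrangian_gibbs_plan[OF gamma x0])
  \<comment> \<open>The Gibbs plan is a minimizer for every real \<open>l\<close>, so the two
    functions are equal outright and one may replace the other inside
    \<open>is_arg_max\<close>.\<close>
  have dual: "dual_objective ?M = entropic_dual x H C \<gamma> \<delta>"
    using INF_eq_is_arg_min[OF min]
    by (auto simp: dual_objective_def lagrangian_gibbs_plan[OF gamma x0])
  have "\<exists>l. is_arg_max (entropic_dual x H C \<gamma> \<delta>) (\<lambda>l. 0 \<le> l) l"
    using C_zero
    by (intro is_arg_max_at_least_if_affine_bound[OF continuous_on_entropic_dual delta(2)
          entropic_dual_affine_bound[OF gamma x0]]) auto
  then show ?thesis
    using min unfolding dual by (auto simp: entropic_dual_def)
qed

end
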